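(* Let $T>0$ and assume $\int_M J(s_{xO})(1+s_{xO}^2)\,d\mu_x<\infty$. Let $u,v\in C(M\times[0,T])\cap L^\infty(M\times(0,T))$, with time derivatives $u_t,v_t$ existing in $M\times(0,T]$, be such that $$u_t-Lu\le v_t-Lv\ \text{ in } M\times(0,T],\qquad u(x,0)\le v(x,0)\ \text{ for all } x\in M.$$ Then $u\le v$ in $M\times[0,T]$.
   Context: $M$ is an $N$-dimensional Riemannian manifold without boundary, $O\in M$ is a fixed point, and there is a family of isometries $\tau_x:M\to M$, $x\in M$, with $\tau_x(x)=O$. $\mu$ is a measure on $M$ invariant under all the isometries $\tau_x$. $s_{xy}$ denotes the geodesic distance between $x,y\in M$. $J:\mathbb{R}_{\ge0}\to\mathbb{R}_{\ge0}$ is a function normalized by $\int_M J(s_{xO})\,d\mu_x=1$. The operator $L$ acts in the $x$ variable by $$Lu(x)=\int_M J(s_{xy})u(y)\,d\mu_y-u(x).$$ At $t=T$ the time derivative is the one-sided (left) derivative. *)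

theory Defs
  imports "HOL-Probability.Probability"
begin

section \<open>Smooth manifolds without boundary\<close>

text \<open>
  Continuous differentiability on an open subset of a normed space, through iterated
  directional derivatives. It is only ever used on open sets.
\<close>

primrec Ck_on :: "nat \<Rightarrow> 'e::real_normed_vector set \<Rightarrow> ('e \<Rightarrow> 'f::real_normed_vector) \<Rightarrow> bool" where
  "Ck_on 0 S f \<longleftrightarrow> continuous_on S f"
| "Ck_on (Suc k) S f \<longleftrightarrow>
     (\<forall>x\<in>S. f differentiable (at x)) \<and> (\<forall>v. Ck_on k S (\<lambda>x. frechet_derivative f (at x) v))"

definition smooth_on :: "'e::real_normed_vector set \<Rightarrow> ('e \<Rightarrow> 'f::real_normed_vector) \<Rightarrow> bool" where
  "smooth_on S f \<longleftrightarrow> (\<forall>k. Ck_on k S f)"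

text \<open>
  The manifold is the whole type \<open>'a\<close>; its dimension is \<open>CARD('n)\<close>. A chart is a pair of
  its domain and the coordinate map, whose values outside the domain are irrelevant.
\<close>

type_synonym ('a, 'n) chart = "'a set \<times> ('a \<Rightarrow> real ^ 'n)"

abbreviation dom_of :: "('a, 'n) chart \<Rightarrow> 'a set" where
  "dom_of c \<equiv> fst c"

abbreviation coord :: "('a, 'n) chart \<Rightarrow> 'a \<Rightarrow> real ^ 'n" where
  "coord c \<equiv> snd c"

abbreviation inv_coord :: "('a, 'n) chart \<Rightarrow> real ^ 'n \<Rightarrow> 'a" where
  "inv_coord c \<equiv> inv_into (dom_of c) (coord c)"

definition is_chart :: "('a::topological_space, 'n::finite) chart \<Rightarrow> bool" where
  "is_chart c \<longleftrightarrow> open (dom_of c) \<and> open (coord c ` dom_of c) \<and>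
     homeomorphism (dom_of c) (coord c ` dom_of c) (coord c) (inv_coord c)"

abbreviation in_coords ::
  "('a, 'n) chart \<Rightarrow> ('a, 'n) chart \<Rightarrow> ('a \<Rightarrow> 'a) \<Rightarrow> real ^ 'n \<Rightarrow> real ^ 'n" where
  "in_coords c d f \<equiv> (\<lambda>z. coord d (f (inv_coord c z)))"

definition smooth_atlas :: "('a::topological_space, 'n::finite) chart set \<Rightarrow> bool" where
  "smooth_atlas A \<longleftrightarrow>
     (\<forall>c\<in>A. is_chart c) \<and> (\<Union>c\<in>A. dom_of c) = UNIV \<and>
     (\<forall>c\<in>A. \<forall>d\<in>A. smooth_on (coord c ` (dom_of c \<inter> dom_of d)) (in_coords c d id))"

definition smooth_map :: "('a::topological_space, 'n::finite) chart set \<Rightarrow> ('a \<Rightarrow> 'a) \<Rightarrow> bool" where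
  "smooth_map A f \<longleftrightarrow> continuous_on UNIV f \<and>
     (\<forall>c\<in>A. \<forall>d\<in>A. smooth_on (coord c ` (dom_of c \<inter> f -` dom_of d)) (in_coords c d f))"

section \<open>Riemannian metrics\<close>

text \<open>
  A metric tensor is given by its local representatives: \<open>g c x v w\<close> is the inner product at
  the point \<open>x\<close> of the tangent vectors whose components in the chart \<open>c\<close> are \<open>v\<close> and \<open>w\<close>.
\<close>

type_synonym ('a, 'n) metric_tensor =
  "('a, 'n) chart \<Rightarrow> 'a \<Rightarrow> real ^ 'n \<Rightarrow> real ^ 'n \<Rightarrow> real"

text \<open>
  \<open>f\<close> pulls back \<open>g\<close> to itself: \<open>g (df v) (df w) = g v w\<close>, in all pairs of charts. For
  \<open>f = id\<close> this is the transformation law of a covariant 2-tensor under change of chart.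
\<close>

definition preserves_tensor ::
  "('a, 'n::finite) chart set \<Rightarrow> ('a, 'n) metric_tensor \<Rightarrow> ('a \<Rightarrow> 'a) \<Rightarrow> bool" where
  "preserves_tensor A g f \<longleftrightarrow>
     (\<forall>c\<in>A. \<forall>d\<in>A. \<forall>x \<in> dom_of c \<inter> f -` dom_of d. \<forall>v w.
        g d (f x) (frechet_derivative (in_coords c d f) (at (coord c x)) v)
                  (frechet_derivative (in_coords c d f) (at (coord c x)) w) = g c x v w)"

definition riemannian_metric ::
  "('a::topological_space, 'n::finite) chart set \<Rightarrow> ('a, 'n) metric_tensor \<Rightarrow> bool" where
  "riemannian_metric A g \<longleftrightarrow>
     (\<forall>c\<in>A. \<forall>x\<in>dom_of c.
        bilinear (g c x) \<and> (\<forall>v w. g c x v w = g c x w v) \<and> (\<forall>v. v \<noteq> 0 \<longrightarrow> g c x v v > 0)) \<and>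
     (\<forall>c\<in>A. \<forall>v w. smooth_on (coord c ` dom_of c) (\<lambda>z. g c (inv_coord c z) v w)) \<and>
     preserves_tensor A g id"

text \<open>Connectedness is what makes the geodesic distance finite.\<close>

definition riemannian_manifold ::
  "('a::{t2_space,second_countable_topology}, 'n::finite) chart set
     \<Rightarrow> ('a, 'n) metric_tensor \<Rightarrow> bool" where
  "riemannian_manifold A g \<longleftrightarrow>
     connected (UNIV :: 'a set) \<and> smooth_atlas A \<and> riemannian_metric A g"

definition riemannian_isometry ::
  "('a::topological_space, 'n::finite) chart set \<Rightarrow> ('a, 'n) metric_tensor
     \<Rightarrow> ('a \<Rightarrow> 'a) \<Rightarrow> bool" where
  "riemannian_isometry A g f \<longleftrightarrow>
     bij f \<and> smooth_map A f \<and> smooth_map A (inv f) \<and> preserves_tensor A g f"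

section \<open>Geodesic distance\<close>

text \<open>Derivatives at the endpoints \<open>a\<close> and \<open>b\<close> are one-sided.\<close>

definition C1_curve_on ::
  "('a::topological_space, 'n::finite) chart set \<Rightarrow> real \<Rightarrow> real \<Rightarrow> (real \<Rightarrow> 'a) \<Rightarrow> bool" where
  "C1_curve_on A a b \<gamma> \<longleftrightarrow> continuous_on {a..b} \<gamma> \<and>
     (\<forall>c\<in>A. \<exists>D. continuous_on ({a..b} \<inter> \<gamma> -` dom_of c) D \<and>
        (\<forall>t \<in> {a..b} \<inter> \<gamma> -` dom_of c.
           ((\<lambda>s. coord c (\<gamma> s)) has_vector_derivative D t) (at t within {a..b})))"

definition piecewise_C1_curve ::
  "('a::topological_space, 'n::finite) chart set \<Rightarrow> (real \<Rightarrow> 'a) \<Rightarrow> bool" where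
  "piecewise_C1_curve A \<gamma> \<longleftrightarrow>
     (\<exists>n p. p 0 = 0 \<and> p n = 1 \<and>
        (\<forall>i<n. p i < p (Suc i) \<and> C1_curve_on A (p i) (p (Suc i)) \<gamma>))"

text \<open>
  The choice of chart does not affect \<open>speed\<close> at times where the curve is differentiable,
  hence for a piecewise \<open>C\<^sup>1\<close> curve it matters at finitely many times at most.
\<close>

definition speed ::
  "('a, 'n::finite) chart set \<Rightarrow> ('a, 'n) metric_tensor \<Rightarrow> (real \<Rightarrow> 'a) \<Rightarrow> real \<Rightarrow> real" where
  "speed A g \<gamma> t =
     (let c = (SOME c. c \<in> A \<and> \<gamma> t \<in> dom_of c);
          v = vector_derivative (\<lambda>s. coord c (\<gamma> s)) (at t)
      in sqrt (g c (\<gamma> t) v v))"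

definition curve_length ::
  "('a, 'n::finite) chart set \<Rightarrow> ('a, 'n) metric_tensor \<Rightarrow> (real \<Rightarrow> 'a) \<Rightarrow> ennreal" where
  "curve_length A g \<gamma> = (\<integral>\<^sup>+t\<in>{0..1}. ennreal (speed A g \<gamma> t) \<partial>lborel)"

definition geodesic_dist ::
  "('a::topological_space, 'n::finite) chart set \<Rightarrow> ('a, 'n) metric_tensor
     \<Rightarrow> 'a \<Rightarrow> 'a \<Rightarrow> real" where
  "geodesic_dist A g x y =
     enn2real (INF \<gamma>\<in>{\<gamma>. piecewise_C1_curve A \<gamma> \<and> \<gamma> 0 = x \<and> \<gamma> 1 = y}. curve_length A g \<gamma>)"

section \<open>The nonlocal operator and function spaces\<close>

definition invariant_measure :: "'a measure \<Rightarrow> ('a \<Rightarrow> 'a) \<Rightarrow> bool" where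
  "invariant_measure \<mu> f \<longleftrightarrow> f \<in> measurable \<mu> \<mu> \<and> distr \<mu> \<mu> f = \<mu>"

definition nonlocal_op ::
  "(real \<Rightarrow> real) \<Rightarrow> ('a \<Rightarrow> 'a \<Rightarrow> real) \<Rightarrow> 'a measure \<Rightarrow> ('a \<Rightarrow> real) \<Rightarrow> 'a \<Rightarrow> real" where
  "nonlocal_op J s \<mu> f x = (\<integral>y. J (s x y) * f y \<partial>\<mu>) - f x"

definition Linfty :: "'b measure \<Rightarrow> ('b \<Rightarrow> real) set" where
  "Linfty \<nu> = {f \<in> borel_measurable \<nu>. \<exists>C. AE z in \<nu>. \<bar>f z\<bar> \<le> C}"

end

theory Submission imports Defs begin

text \<open>Isometries preserve the geodesic distance \<open>s\<close>, and \<open>s\<close> is symmetric, so that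
  \<open>s x y = s (\<tau>\<^sub>x y) O\<close> and the kernel \<open>J (s x y)\<close> has mass one in \<open>y\<close> for every \<open>x\<close>. For
  \<open>w = u - v\<close> the function \<open>z = e\<^sup>t w\<close> then satisfies \<open>z\<^sub>t \<le> \<integral> J (s x y) z(y, t)\<close> and
  \<open>z \<le> 0\<close> initially. Hence a bound \<open>z \<le> K\<close> improves successively to
  \<open>z \<le> K t\<^sup>n / n!\<close>, and letting \<open>n \<rightarrow> \<infinity>\<close> gives \<open>z \<le> 0\<close>.\<close>

section \<open>Invariance and symmetry of the geodesic distance\<close>

lemma smooth_on_differentiable: "smooth_on S f \<Longrightarrow> x \<in> S \<Longrightarrow> f differentiable (at x)"
  unfolding smooth_on_def by (drule spec[of _ "Suc 0"]) simp

lemma smooth_on_continuous_frechet_derivative: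
  "smooth_on S f \<Longrightarrow> continuous_on S (\<lambda>x. frechet_derivative f (at x) v)"
  unfolding smooth_on_def by (drule spec[of _ "Suc 0"]) simp

text \<open>Smoothness supplies continuity of the derivative only in a fixed direction
  \<open>v\<close>. For a moving direction, linearity lets \<open>D t\<close> be expanded in the
  basis, which leaves finitely many fixed directions.\<close>

lemma smooth_on_continuous_on_derivative_apply:
  fixes f :: "'e::euclidean_space \<Rightarrow> 'f::real_normed_vector"
  assumes f: "smooth_on S f" and p: "continuous_on B p" "p ` B \<subseteq> S" and D: "continuous_on B D"
  shows "continuous_on B (\<lambda>t. frechet_derivative f (at (p t)) (D t))"
proof -
  have "continuous_on B (\<lambda>t. \<Sum>b\<in>Basis. (D t \<bullet> b) *\<^sub>R frechet_derivative f (at (p t)) b)"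
    using continuous_on_compose2[OF smooth_on_continuous_frechet_derivative[OF f] p]
    by (intro continuous_intros D)
  moreover have "(\<Sum>b\<in>Basis. (D t \<bullet> b) *\<^sub>R frechet_derivative f (at (p t)) b) =
      frechet_derivative f (at (p t)) (D t)" if "t \<in> B" for t
  proof -
    interpret linear "frechet_derivative f (at (p t))"
      using smooth_on_differentiable[OF f] p(2) that by (intro linear_frechet_derivative) auto
    show ?thesis
      using euclidean_representation[of "D t"] by (metis (no_types, lifting) sum scale sum.cong)
  qed
  ultimately show ?thesis by (simp cong: continuous_on_cong)
qed

lemma smooth_atlas_chart: "smooth_atlas A \<Longrightarrow> c \<in> A \<Longrightarrow> is_chart c"
  by (simp add: smooth_atlas_def)

lemma smooth_atlas_chart_at:
  assumes "smooth_atlas A"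
  obtains c where "c \<in> A" "x \<in> dom_of c"
  using assms that unfolding smooth_atlas_def by (metis UNIV_I UN_E)

lemma inv_coord_coord: "is_chart c \<Longrightarrow> x \<in> dom_of c \<Longrightarrow> inv_coord c (coord c x) = x"
  by (auto simp: is_chart_def dest: homeomorphism_apply1)

text \<open>Near \<open>t\<close> the curve stays in the open domain of \<open>c\<close>, so there
  \<open>coord d (f (\<gamma> s))\<close> factors through \<open>coord c\<close> and the chain rule
  applies. Working within \<open>S\<close> serves one-sided derivatives on closed pieces as well as
  two-sided ones.\<close>

lemma has_vector_derivative_in_coords:
  assumes A: "smooth_atlas A" and f: "smooth_map A f" and cd: "c \<in> A" "d \<in> A"
    and t: "t \<in> S" "\<gamma> t \<in> dom_of c" "f (\<gamma> t) \<in> dom_of d"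
    and cont: "continuous (at t within S) \<gamma>"
    and deriv: "((\<lambda>s. coord c (\<gamma> s)) has_vector_derivative D) (at t within S)"
  shows "((\<lambda>s. coord d (f (\<gamma> s))) has_vector_derivative
    frechet_derivative (in_coords c d f) (at (coord c (\<gamma> t))) D) (at t within S)"
proof -
  let ?F = "in_coords c d f"
  have "?F differentiable (at (coord c (\<gamma> t)))"
    using f cd t unfolding smooth_map_def by (intro smooth_on_differentiable) auto
  then have "(?F has_derivative frechet_derivative ?F (at (coord c (\<gamma> t)))) (at (coord c (\<gamma> t)))"
    by (simp add: frechet_derivative_works)
  then have F: "((?F \<circ> (\<lambda>s. coord c (\<gamma> s))) has_vector_derivative
      frechet_derivative ?F (at (coord c (\<gamma> t))) D) (at t within S)"
    by (rule vector_derivative_diff_chain_within[OF deriv has_derivative_at_withinI])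
  have "open (dom_of c)"
    using smooth_atlas_chart[OF A cd(1)] by (simp add: is_chart_def)
  then have "\<forall>\<^sub>F s in at t within S. \<gamma> s \<in> dom_of c"
    using cont t(2) unfolding continuous_within by (rule_tac topological_tendstoD)
  then have "\<forall>\<^sub>F s in at t within S. (?F \<circ> (\<lambda>s. coord c (\<gamma> s))) s = coord d (f (\<gamma> s))"
    by eventually_elim (simp add: inv_coord_coord[OF smooth_atlas_chart[OF A cd(1)]])
  then show ?thesis
    using has_derivative_transform_eventually[OF F[unfolded has_vector_derivative_def] _ _ t(1)] t(2)
    by (simp add: has_vector_derivative_def inv_coord_coord[OF smooth_atlas_chart[OF A cd(1)]])
qed

section \<open>Images and reversals of piecewise C1 curves\<close>

text \<open>One continuous derivative is required on the whole preimage of \<open>dom_of d\<close>,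
  although the original curve may cross several charts \<open>c\<close> there.
  \<open>vector_derivative\<close> is a global candidate; uniqueness of derivatives on a
  nondegenerate interval identifies it locally with the chain rule expression in each
  \<open>c\<close>.\<close>

lemma C1_curve_on_smooth_map:
  assumes A: "smooth_atlas A" and f: "smooth_map A f" and ab: "a < b"
    and \<gamma>: "C1_curve_on A a b \<gamma>"
  shows "C1_curve_on A a b (\<lambda>t. f (\<gamma> t))"
  unfolding C1_curve_on_def
proof (intro conjI ballI)
  have cont: "continuous_on {a..b} \<gamma>" using \<gamma> by (simp add: C1_curve_on_def)
  have cont_f: "continuous_on UNIV f" using f by (simp add: smooth_map_def)
  show cont_f\<gamma>: "continuous_on {a..b} (\<lambda>t. f (\<gamma> t))"
    by (rule continuous_on_compose2[OF cont_f cont]) simp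
  fix d assume d: "d \<in> A"
  let ?D = "\<lambda>t. vector_derivative (\<lambda>s. coord d (f (\<gamma> s))) (at t within {a..b})"
  let ?B = "{a..b} \<inter> (\<lambda>t. f (\<gamma> t)) -` dom_of d"
  have local: "((\<lambda>s. coord d (f (\<gamma> s))) has_vector_derivative ?D t) (at t within {a..b}) \<and>
      continuous (at t within ?B) ?D" if t: "t \<in> ?B" for t
  proof -
    obtain c where c: "c \<in> A" "\<gamma> t \<in> dom_of c" using smooth_atlas_chart_at[OF A] .
    obtain E where contE: "continuous_on ({a..b} \<inter> \<gamma> -` dom_of c) E"
      and E: "\<And>t. t \<in> {a..b} \<inter> \<gamma> -` dom_of c \<Longrightarrow>
        ((\<lambda>s. coord c (\<gamma> s)) has_vector_derivative E t) (at t within {a..b})"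
      using \<gamma> c(1) unfolding C1_curve_on_def by blast
    let ?B' = "?B \<inter> \<gamma> -` dom_of c"
    let ?G = "\<lambda>t. frechet_derivative (in_coords c d f) (at (coord c (\<gamma> t))) (E t)"
    have G: "((\<lambda>s. coord d (f (\<gamma> s))) has_vector_derivative ?G r) (at r within {a..b})"
      if "r \<in> ?B'" for r
      using that cont c d
      by (intro has_vector_derivative_in_coords[OF A f] E)
        (auto simp: continuous_on_eq_continuous_within)
    have D_eq: "?D r = ?G r" if "r \<in> ?B'" for r
      using vector_derivative_within_closed_interval[OF ab _ G] that by auto
    have "open (dom_of c)" and hom: "continuous_on (dom_of c) (coord c)"
      using smooth_atlas_chart[OF A] c d by (auto simp: is_chart_def homeomorphism_def)
    have "continuous_on ?B' (\<lambda>t. coord c (\<gamma> t))"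
      using cont by (intro continuous_on_compose2[OF hom]) (auto intro: continuous_on_subset)
    then have "continuous_on ?B' ?G"
      using f c d by (intro smooth_on_continuous_on_derivative_apply[
            of "coord c ` (dom_of c \<inter> f -` dom_of d)"] continuous_on_subset[OF contE])
        (auto simp: smooth_map_def)
    then have "continuous_on ?B' ?D"
      by (rule continuous_on_eq) (rule D_eq[symmetric])
    then have "continuous (at t within ?B') ?D"
      using t c by (simp add: continuous_on_eq_continuous_within)
    \<comment> \<open>The part of the interval mapped into \<open>dom_of c\<close> is relatively
      open, so restricting to it does not change the limit at \<open>t\<close>.\<close>
    moreover have "at t within ?B' = at t within ?B"
    proof -
      have "openin (top_of_set {a..b}) ({a..b} \<inter> \<gamma> -` dom_of c)"
        using continuous_openin_preimage_gen[OF cont \<open>open (dom_of c)\<close>] .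
      then obtain U where U: "open U" "{a..b} \<inter> \<gamma> -` dom_of c = {a..b} \<inter> U"
        by (auto simp: openin_open)
      then have "t \<in> U" "?B' \<inter> U - {t} = ?B \<inter> U - {t}" using t c by blast+
      then show ?thesis using U(1) by (intro at_within_nhd[of t U])
    qed
    ultimately show ?thesis using G[of t] D_eq[of t] t c by auto
  qed
  show "\<exists>D. continuous_on ?B D \<and> (\<forall>t\<in>?B.
      ((\<lambda>s. coord d (f (\<gamma> s))) has_vector_derivative D t) (at t within {a..b}))"
    using local by (intro exI[of _ ?D]) (auto simp: continuous_on_eq_continuous_within)
qed

lemma piecewise_C1_curve_smooth_map:
  assumes "smooth_atlas A" "smooth_map A f" "piecewise_C1_curve A \<gamma>"
  shows "piecewise_C1_curve A (\<lambda>t. f (\<gamma> t))"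
  using assms(3) C1_curve_on_smooth_map[OF assms(1,2)] unfolding piecewise_C1_curve_def by blast

lemma C1_curve_on_reverse:
  assumes "C1_curve_on A a b \<gamma>"
  shows "C1_curve_on A (1 - b) (1 - a) (\<lambda>t. \<gamma> (1 - t))"
  unfolding C1_curve_on_def
proof (intro conjI ballI)
  show "continuous_on {1 - b..1 - a} (\<lambda>t. \<gamma> (1 - t))"
    using assms unfolding C1_curve_on_def
    by (intro continuous_on_compose2[of "{a..b}" \<gamma> _ "\<lambda>t. 1 - t"] continuous_intros) auto
  fix c assume "c \<in> A"
  then obtain D where cont: "continuous_on ({a..b} \<inter> \<gamma> -` dom_of c) D"
    and D: "\<And>t. t \<in> {a..b} \<inter> \<gamma> -` dom_of c \<Longrightarrow>
      ((\<lambda>s. coord c (\<gamma> s)) has_vector_derivative D t) (at t within {a..b})"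
    using assms unfolding C1_curve_on_def by blast
  let ?B = "{1 - b..1 - a} \<inter> (\<lambda>t. \<gamma> (1 - t)) -` dom_of c"
  have "continuous_on ?B (\<lambda>t. - D (1 - t))"
    by (intro continuous_intros continuous_on_compose2[OF cont, of _ "\<lambda>t. 1 - t"]) auto
  moreover have "((\<lambda>s. coord c (\<gamma> (1 - s))) has_vector_derivative - D (1 - t))
      (at t within {1 - b..1 - a})" if "t \<in> ?B" for t
  proof -
    have "((\<lambda>s. 1 - s) has_vector_derivative -1) (at t within {1 - b..1 - a})"
      by (auto intro!: derivative_eq_intros)
    moreover have "((\<lambda>s. coord c (\<gamma> s)) has_vector_derivative D (1 - t))
        (at (1 - t) within (\<lambda>s. 1 - s) ` {1 - b..1 - a})"
      using D[of "1 - t"] that by (auto simp: image_diff_atLeastAtMost)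
    ultimately show ?thesis
      using vector_diff_chain_within by (fastforce simp: o_def)
  qed
  ultimately show "\<exists>D. continuous_on ?B D \<and> (\<forall>t\<in>?B.
      ((\<lambda>s. coord c (\<gamma> (1 - s))) has_vector_derivative D t) (at t within {1 - b..1 - a}))"
    by (intro exI[of _ "\<lambda>t. - D (1 - t)"]) auto
qed

lemma piecewise_C1_curve_reverse:
  assumes "piecewise_C1_curve A \<gamma>"
  shows "piecewise_C1_curve A (\<lambda>t. \<gamma> (1 - t))"
proof -
  obtain n p where p: "p 0 = 0" "p n = 1"
    and \<gamma>: "\<And>i. i < n \<Longrightarrow> p i < p (Suc i) \<and> C1_curve_on A (p i) (p (Suc i)) \<gamma>"
    using assms unfolding piecewise_C1_curve_def by blast
  \<comment> \<open>Reflection reverses the order of the break points, hence the renumbering from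
    the end: piece \<open>i\<close> of the reversed curve is piece \<open>n - Suc i\<close> of the
    original.\<close>
  let ?q = "\<lambda>i. 1 - p (n - i)"
  have "?q i < ?q (Suc i) \<and> C1_curve_on A (?q i) (?q (Suc i)) (\<lambda>t. \<gamma> (1 - t))" if "i < n" for i
    using \<gamma>[of "n - Suc i"] that C1_curve_on_reverse[of A "p (n - Suc i)" "p (n - i)" \<gamma>]
    by (simp add: Suc_diff_Suc)
  then show ?thesis
    unfolding piecewise_C1_curve_def using p by (intro exI[of _ n] exI[of _ ?q]) auto
qed

section \<open>Differentiability away from the break points\<close>

text \<open>All charts around the point are covered, so that it applies to whichever chart
  \<open>speed\<close> selects. Continuity is included for the chain rule in charts.\<close>

definition differentiable_curve_at ::
  "('a::topological_space, 'n::finite) chart set \<Rightarrow> (real \<Rightarrow> 'a) \<Rightarrow> real \<Rightarrow> bool" where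
  "differentiable_curve_at A \<gamma> t \<longleftrightarrow> isCont \<gamma> t \<and>
     (\<forall>c\<in>A. \<gamma> t \<in> dom_of c \<longrightarrow> (\<lambda>s. coord c (\<gamma> s)) differentiable (at t))"

text \<open>\<open>speed\<close> uses the two-sided derivative, \<open>C1_curve_on\<close> the
  derivative within the closed interval; at interior points the two filters coincide.\<close>

lemma C1_curve_on_differentiable_curve_at:
  assumes \<gamma>: "C1_curve_on A a b \<gamma>" and t: "a < t" "t < b"
  shows "differentiable_curve_at A \<gamma> t"
proof -
  have at: "at t within {a..b} = at t" using t by (intro at_within_Icc_at)
  have "isCont \<gamma> t"
    using \<gamma> t at unfolding C1_curve_on_def continuous_on_eq_continuous_within
    by (metis atLeastAtMost_iff less_imp_le)
  moreover have "(\<lambda>s. coord c (\<gamma> s)) differentiable (at t)"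
    if c: "c \<in> A" "\<gamma> t \<in> dom_of c" for c
  proof -
    obtain D where D: "continuous_on ({a..b} \<inter> \<gamma> -` dom_of c) D"
      "\<And>t. t \<in> {a..b} \<inter> \<gamma> -` dom_of c \<Longrightarrow>
        ((\<lambda>s. coord c (\<gamma> s)) has_vector_derivative D t) (at t within {a..b})"
      using \<gamma> c(1) unfolding C1_curve_on_def by blast
    have "((\<lambda>s. coord c (\<gamma> s)) has_vector_derivative D t) (at t)"
      using D(2)[of t] t c(2) unfolding at by simp
    then show ?thesis by (rule differentiableI_vector)
  qed
  ultimately show ?thesis unfolding differentiable_curve_at_def by blast
qed

lemma piecewise_C1_curve_AE_differentiable_curve_at:
  assumes "piecewise_C1_curve A \<gamma>"
  shows "AE t in lborel. t \<in> {0..1} \<longrightarrow> differentiable_curve_at A \<gamma> t"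
proof -
  obtain n p where p: "p 0 = 0" "p n = 1"
    and \<gamma>: "\<And>i. i < n \<Longrightarrow> C1_curve_on A (p i) (p (Suc i)) \<gamma>"
    using assms unfolding piecewise_C1_curve_def by blast
  have "AE t in lborel. t \<notin> p ` {..n}"
    by (intro AE_not_in finite_imp_null_set_lborel) auto
  then show ?thesis
  proof eventually_elim
    case (elim t)
    show ?case
    proof
      assume "t \<in> {0..1}"
      then have ex: "t \<le> p n" and "\<not> t \<le> p 0" using p elim by force+
      obtain i where "i \<le> n" "\<not> t \<le> p i" "t \<le> p (Suc i)" "Suc i \<le> n"
      proof -
        \<comment> \<open>The least such index is not 0, and its predecessor is the left end of the
          piece containing \<open>t\<close>.\<close>
        define j where "j = (LEAST j. t \<le> p j)"
        have j: "t \<le> p j" "j \<le> n" using ex unfolding j_def by (auto intro: LeastI Least_le)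
        then obtain i where i: "j = Suc i" using \<open>\<not> t \<le> p 0\<close> by (cases j) auto
        then have "\<not> t \<le> p i" unfolding j_def by (metis lessI not_less_Least)
        then show thesis using that[of i] i j by auto
      qed
      moreover have "t \<noteq> p (Suc i)" using elim \<open>Suc i \<le> n\<close> by auto
      ultimately show "differentiable_curve_at A \<gamma> t"
        using C1_curve_on_differentiable_curve_at[OF \<gamma>[of i]] by auto
    qed
  qed
qed

section \<open>Length and distance under isometries\<close>

text \<open>The velocity of the image curve in \<open>d\<close> is the differential of
  \<open>f\<close> applied to the velocity in \<open>c\<close>. The charts \<open>c\<close> and
  \<open>d\<close> are selected independently, which is harmless because
  \<open>preserves_tensor\<close> covers every pair.\<close>

lemma speed_isometry:
  assumes A: "smooth_atlas A" and f: "smooth_map A f" "preserves_tensor A g f"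
    and \<gamma>: "differentiable_curve_at A \<gamma> t"
  shows "speed A g (\<lambda>t. f (\<gamma> t)) t = speed A g \<gamma> t"
proof -
  define c where "c = (SOME c. c \<in> A \<and> \<gamma> t \<in> dom_of c)"
  define d where "d = (SOME c. c \<in> A \<and> f (\<gamma> t) \<in> dom_of c)"
  have c: "c \<in> A" "\<gamma> t \<in> dom_of c"
    using someI_ex[of "\<lambda>c. c \<in> A \<and> \<gamma> t \<in> dom_of c"] smooth_atlas_chart_at[OF A]
    unfolding c_def by metis+
  have d: "d \<in> A" "f (\<gamma> t) \<in> dom_of d"
    using someI_ex[of "\<lambda>c. c \<in> A \<and> f (\<gamma> t) \<in> dom_of c"] smooth_atlas_chart_at[OF A]
    unfolding d_def by metis+
  let ?v = "vector_derivative (\<lambda>s. coord c (\<gamma> s)) (at t)"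
  let ?w = "vector_derivative (\<lambda>s. coord d (f (\<gamma> s))) (at t)"
  have "((\<lambda>s. coord c (\<gamma> s)) has_vector_derivative ?v) (at t)"
    using \<gamma> c unfolding differentiable_curve_at_def by (simp add: vector_derivative_works)
  then have "?w = frechet_derivative (in_coords c d f) (at (coord c (\<gamma> t))) ?v"
    using \<gamma> c d unfolding differentiable_curve_at_def
    by (intro vector_derivative_at has_vector_derivative_in_coords[OF A f(1)]) auto
  then have "g d (f (\<gamma> t)) ?w ?w = g c (\<gamma> t) ?v ?v"
    using f(2) c d unfolding preserves_tensor_def by auto
  then show ?thesis
    unfolding speed_def Let_def c_def[symmetric] d_def[symmetric] by simp
qed

lemma curve_length_isometry:
  assumes "smooth_atlas A" "smooth_map A f" "preserves_tensor A g f" "piecewise_C1_curve A \<gamma>"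
  shows "curve_length A g (\<lambda>t. f (\<gamma> t)) = curve_length A g \<gamma>"
  unfolding curve_length_def
proof (rule nn_integral_cong_AE)
  show "AE t in lborel. ennreal (speed A g (\<lambda>t. f (\<gamma> t)) t) * indicator {0..1} t =
      ennreal (speed A g \<gamma> t) * indicator {0..1} t"
    using piecewise_C1_curve_AE_differentiable_curve_at[OF assms(4)]
    by eventually_elim (simp add: speed_isometry[OF assms(1-3)] indicator_def)
qed

text \<open>Composition with \<open>f\<close> maps the curves from \<open>x\<close> to
  \<open>y\<close> onto those from \<open>f x\<close> to \<open>f y\<close>, a preimage being given
  by \<open>inv f\<close>. Lengths are preserved, so both infima run over the same set of
  lengths.\<close>

lemma geodesic_dist_isometry:
  assumes A: "smooth_atlas A" and f: "riemannian_isometry A g f"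
  shows "geodesic_dist A g (f x) (f y) = geodesic_dist A g x y"
proof -
  let ?C = "\<lambda>x y. {\<gamma>. piecewise_C1_curve A \<gamma> \<and> \<gamma> 0 = x \<and> \<gamma> 1 = y}"
  have f': "bij f" "smooth_map A f" "smooth_map A (inv f)" "preserves_tensor A g f"
    using f by (auto simp: riemannian_isometry_def)
  have "?C (f x) (f y) = (\<lambda>\<gamma> t. f (\<gamma> t)) ` ?C x y"
  proof (intro set_eqI iffI)
    fix \<gamma> assume \<gamma>: "\<gamma> \<in> ?C (f x) (f y)"
    then have "(\<lambda>t. inv f (\<gamma> t)) \<in> ?C x y"
      using piecewise_C1_curve_smooth_map[OF A f'(3)] f'(1) by (auto simp: bij_is_inj)
    moreover have "\<gamma> = (\<lambda>t. f (inv f (\<gamma> t)))"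
      using f'(1) by (simp add: bij_is_surj surj_f_inv_f)
    ultimately show "\<gamma> \<in> (\<lambda>\<gamma> t. f (\<gamma> t)) ` ?C x y" by (rule_tac image_eqI)
  qed (auto intro: piecewise_C1_curve_smooth_map[OF A f'(2)])
  then have "curve_length A g ` ?C (f x) (f y) = (\<lambda>\<gamma>. curve_length A g (\<lambda>t. f (\<gamma> t))) ` ?C x y"
    by (simp only: image_image)
  also have "\<dots> = curve_length A g ` ?C x y"
    by (rule image_cong) (simp_all add: curve_length_isometry[OF A f'(2,4)])
  finally show ?thesis unfolding geodesic_dist_def by simp
qed

section \<open>Symmetry of the distance\<close>

text \<open>Both speeds select a chart at the same point, hence the same chart. Reversal only
  negates the velocity, and the sign cancels in the quadratic form.\<close>

lemma speed_reverse:
  assumes A: "smooth_atlas A" and g: "riemannian_metric A g"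
    and \<gamma>: "differentiable_curve_at A \<gamma> (1 - t)"
  shows "speed A g (\<lambda>t. \<gamma> (1 - t)) t = speed A g \<gamma> (1 - t)"
proof -
  define c where "c = (SOME c. c \<in> A \<and> \<gamma> (1 - t) \<in> dom_of c)"
  have c: "c \<in> A" "\<gamma> (1 - t) \<in> dom_of c"
    using someI_ex[of "\<lambda>c. c \<in> A \<and> \<gamma> (1 - t) \<in> dom_of c"] smooth_atlas_chart_at[OF A]
    unfolding c_def by metis+
  let ?v = "vector_derivative (\<lambda>s. coord c (\<gamma> s)) (at (1 - t))"
  let ?w = "vector_derivative (\<lambda>s. coord c (\<gamma> (1 - s))) (at t)"
  have "((\<lambda>s. coord c (\<gamma> s)) has_vector_derivative ?v) (at (1 - t))"
    using \<gamma> c unfolding differentiable_curve_at_def by (simp add: vector_derivative_works)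
  moreover have "((\<lambda>s. 1 - s) has_vector_derivative -1) (at t)"
    by (auto intro!: derivative_eq_intros)
  ultimately have "((\<lambda>s. coord c (\<gamma> (1 - s))) has_vector_derivative - ?v) (at t)"
    using vector_diff_chain_at by (fastforce simp: o_def)
  then have "?w = - ?v" by (rule vector_derivative_at)
  moreover have "bilinear (g c (\<gamma> (1 - t)))"
    using g c unfolding riemannian_metric_def by blast
  ultimately have "g c (\<gamma> (1 - t)) ?w ?w = g c (\<gamma> (1 - t)) ?v ?v"
    by (simp add: bilinear_lneg bilinear_rneg)
  then show ?thesis
    unfolding speed_def Let_def c_def[symmetric] by simp
qed

text \<open>This is for possibly nonmeasurable \<open>f\<close>, because \<open>speed\<close> depends on an arbitrary choice of
  charts; \<open>nn_integral_distr\<close> does not apply.\<close>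

lemma nn_integral_le_measure_preserving:
  assumes T: "T \<in> measurable M M" "distr M M T = M"
  shows "(\<integral>\<^sup>+ x. f x \<partial>M) \<le> (\<integral>\<^sup>+ x. f (T x) \<partial>M)"
  unfolding nn_integral_def[of M f]
proof (rule SUP_least, safe)
  fix h assume h: "simple_function M h" "h \<le> f"
  \<comment> \<open>The left integral is a supremum over simple functions \<open>h\<close> below
    \<open>f\<close>. Each \<open>h\<close> is measurable, so the change of variables is legitimate
    for it.\<close>
  have "integral\<^sup>S M h = (\<integral>\<^sup>+ x. h x \<partial>distr M M T)"
    using h(1) T(2) by (simp add: nn_integral_eq_simple_integral)
  also have "\<dots> = (\<integral>\<^sup>+ x. h (T x) \<partial>M)"
    using h(1) T by (intro nn_integral_distr) (auto intro: borel_measurable_simple_function)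
  also have "\<dots> \<le> (\<integral>\<^sup>+ x. f (T x) \<partial>M)"
    using h(2) by (intro nn_integral_mono) (auto simp: le_fun_def)
  finally show "integral\<^sup>S M h \<le> (\<integral>\<^sup>+ x. f (T x) \<partial>M)" .
qed

text \<open>The reflection is an involution, so the one-sided inequality, applied to
  \<open>f\<close> and to its reflection, gives both directions.\<close>

lemma nn_integral_lborel_reflect:
  "(\<integral>\<^sup>+ t. f (1 - t) \<partial>lborel) = (\<integral>\<^sup>+ t. f t \<partial>(lborel :: real measure))"
proof (rule antisym)
  have distr: "distr lborel lborel (\<lambda>t. 1 - t) = (lborel :: real measure)"
    using lborel_real_affine[of "-1" 1] by (simp add: density_1 cong: distr_cong)
  show "(\<integral>\<^sup>+ t. f t \<partial>lborel) \<le> (\<integral>\<^sup>+ t. f (1 - t) \<partial>(lborel :: real measure))"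
    by (rule nn_integral_le_measure_preserving[OF _ distr]) simp
  show "(\<integral>\<^sup>+ t. f (1 - t) \<partial>lborel) \<le> (\<integral>\<^sup>+ t. f t \<partial>(lborel :: real measure))"
    using nn_integral_le_measure_preserving[OF _ distr, of "\<lambda>t. f (1 - t)"] by simp
qed

lemma curve_length_reverse:
  assumes A: "smooth_atlas A" and g: "riemannian_metric A g" and \<gamma>: "piecewise_C1_curve A \<gamma>"
  shows "curve_length A g (\<lambda>t. \<gamma> (1 - t)) = curve_length A g \<gamma>"
proof -
  \<comment> \<open>\<open>speed_reverse\<close> is applied to the reversed curve, so that
    differentiability is asked for at \<open>t\<close> itself, where the almost everywhere statement
    for that curve supplies it.\<close>
  have eq: "speed A g \<gamma> (1 - t) = speed A g (\<lambda>t. \<gamma> (1 - t)) t"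
    if "differentiable_curve_at A (\<lambda>t. \<gamma> (1 - t)) t" for t
    using speed_reverse[OF A g, of "\<lambda>t. \<gamma> (1 - t)" "1 - t"] that by simp
  have "curve_length A g (\<lambda>t. \<gamma> (1 - t)) =
      (\<integral>\<^sup>+ t. ennreal (speed A g \<gamma> (1 - t)) * indicator {0..1} (1 - t) \<partial>lborel)"
    unfolding curve_length_def
  proof (rule nn_integral_cong_AE)
    show "AE t in lborel. ennreal (speed A g (\<lambda>t. \<gamma> (1 - t)) t) * indicator {0..1} t =
        ennreal (speed A g \<gamma> (1 - t)) * indicator {0..1} (1 - t)"
      using piecewise_C1_curve_AE_differentiable_curve_at[OF piecewise_C1_curve_reverse[OF \<gamma>]]
      by eventually_elim (auto simp: eq indicator_def)
  qed
  then show ?thesis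
    unfolding curve_length_def
    using nn_integral_lborel_reflect[of "\<lambda>t. ennreal (speed A g \<gamma> t) * indicator {0..1} t"] by simp
qed

lemma geodesic_dist_commute:
  assumes A: "smooth_atlas A" and g: "riemannian_metric A g"
  shows "geodesic_dist A g x y = geodesic_dist A g y x"
proof -
  let ?C = "\<lambda>x y. {\<gamma>. piecewise_C1_curve A \<gamma> \<and> \<gamma> 0 = x \<and> \<gamma> 1 = y}"
  have "?C x y = (\<lambda>\<gamma> t. \<gamma> (1 - t)) ` ?C y x"
  proof (intro set_eqI iffI)
    fix \<gamma> assume \<gamma>: "\<gamma> \<in> ?C x y"
    then have "(\<lambda>t. \<gamma> (1 - t)) \<in> ?C y x" by (auto intro: piecewise_C1_curve_reverse)
    then show "\<gamma> \<in> (\<lambda>\<gamma> t. \<gamma> (1 - t)) ` ?C y x" by (intro image_eqI) auto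
  qed (auto intro: piecewise_C1_curve_reverse)
  then have "curve_length A g ` ?C x y = (\<lambda>\<gamma>. curve_length A g (\<lambda>t. \<gamma> (1 - t))) ` ?C y x"
    by (simp only: image_image)
  also have "\<dots> = curve_length A g ` ?C y x"
    by (rule image_cong) (simp_all add: curve_length_reverse[OF A g])
  finally show ?thesis unfolding geodesic_dist_def by simp
qed


section \<open>The comparison principle\<close>

text \<open>The section measures of a null set integrate to 0, so almost all of them vanish.
  Sigma-finiteness is placed on the second factor, which will be time; the first will be \<mu>, for
  which it is not assumed.\<close>

lemma (in sigma_finite_measure) AE_pair_left:
  assumes "AE z in N \<Otimes>\<^sub>M M. Q z"
  shows "AE x in N. AE y in M. Q (x, y)"
proof -
  obtain Z where Z: "Z \<in> sets (N \<Otimes>\<^sub>M M)" "emeasure (N \<Otimes>\<^sub>M M) Z = 0"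
    "{z \<in> space (N \<Otimes>\<^sub>M M). \<not> Q z} \<subseteq> Z"
    using assms unfolding eventually_ae_filter by auto
  have "(\<integral>\<^sup>+ x. emeasure M (Pair x -` Z) \<partial>N) = 0"
    using emeasure_pair_measure_alt[OF Z(1)] Z(2) by simp
  then have "AE x in N. emeasure M (Pair x -` Z) = 0"
    using measurable_emeasure_Pair[OF Z(1)] by (simp add: nn_integral_0_iff_AE)
  then show ?thesis
    using AE_space
  proof eventually_elim
    case (elim x)
    show ?case
    proof (rule AE_I)
      show "emeasure M (Pair x -` Z) = 0" "Pair x -` Z \<in> sets M"
        using elim(1) sets_Pair1[OF Z(1)] by auto
      show "{y \<in> space M. \<not> Q (x, y)} \<subseteq> Pair x -` Z"
        using Z(3) elim(2) by (auto simp: space_pair_measure)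
    qed
  qed
qed

text \<open>For almost every \<open>x\<close> the bound holds at almost every time, and continuity
  in time extends it to every time. The exceptional set of points thus does not depend on
  \<open>t\<close>, so the bound can be used inside the space integral at each time.\<close>

lemma Linfty_AE_bounded_in_time:
  fixes f :: "'a \<Rightarrow> real \<Rightarrow> real"
  assumes Linfty: "(\<lambda>(x, t). f x t) \<in> Linfty (\<mu> \<Otimes>\<^sub>M restrict_space lborel {0<..<T})"
    and cont: "\<And>x. continuous_on {0<..<T} (f x)"
  obtains C where "AE x in \<mu>. \<forall>t\<in>{0<..<T}. \<bar>f x t\<bar> \<le> C"
proof -
  obtain C where C: "AE z in \<mu> \<Otimes>\<^sub>M restrict_space lborel {0<..<T}. \<bar>case z of (x, t) \<Rightarrow> f x t\<bar> \<le> C"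
    using Linfty unfolding Linfty_def by auto
  interpret sigma_finite_measure "restrict_space lborel {0<..<T}"
    by (rule sigma_finite_measure_restrict_space) (auto intro: lborel.sigma_finite_measure_axioms)
  have "AE x in \<mu>. AE t in restrict_space lborel {0<..<T}. \<bar>f x t\<bar> \<le> C"
    using AE_pair_left[OF C] by simp
  then have "AE x in \<mu>. \<forall>t\<in>{0<..<T}. \<bar>f x t\<bar> \<le> C"
  proof eventually_elim
    case (elim x)
    then have ae: "AE t \<in> {0<..<T} in lborel. \<bar>f x t\<bar> \<le> C"
      by (subst (asm) AE_restrict_space_iff) auto
    show ?case
    proof (rule ccontr)
      let ?U = "{0<..<T} \<inter> (\<lambda>t. \<bar>f x t\<bar>) -` {C<..}"
      assume "\<not> (\<forall>t\<in>{0<..<T}. \<bar>f x t\<bar> \<le> C)"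
      then obtain t where "t \<in> ?U" by force
      moreover have "open ?U"
        by (intro continuous_open_preimage continuous_intros cont open_greaterThanLessThan open_greaterThan)
      \<comment> \<open>A closed set containing almost every point of an open set contains all of
        it. With the empty set as the closed set, this makes \<open>?U\<close> empty.\<close>
      moreover have "AE t \<in> ?U in lebesgue. t \<in> {}"
        using ae by (intro AE_completion) (auto elim!: eventually_mono)
      ultimately show False
        using mem_closed_if_AE_lebesgue_open[of ?U "{}" t] by blast
    qed
  qed
  then show ?thesis by (rule that)
qed

section \<open>Iteration for subsolutions of the nonlocal equation\<close>

lemma integrable_mult_AE_bounded:
  fixes k f :: "'a \<Rightarrow> real"
  assumes "integrable M k" "f \<in> borel_measurable M" "AE y in M. \<bar>f y\<bar> \<le> C"
  shows "integrable M (\<lambda>y. k y * f y)"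
proof (rule Bochner_Integration.integrable_bound)
  show "integrable M (\<lambda>y. C * k y)" using assms(1) by simp
  show "(\<lambda>y. k y * f y) \<in> borel_measurable M" using assms(1,2) by measurable
  show "AE y in M. norm (k y * f y) \<le> norm (C * k y)"
    using assms(3)
    by eventually_elim (auto simp: abs_mult mult.commute[of "\<bar>k _\<bar>"] intro!: mult_right_mono)
qed

text \<open>Bounding the supremum of \<open>e\<^sup>t w\<close> by Picard iteration replaces the search for a maximum,
  which need not be attained. Starting from an almost everywhere bound suffices because the
  first step already gives an everywhere bound.\<close>

lemma nonlocal_subsolution_nonpos:
  fixes w w' :: "'a \<Rightarrow> real \<Rightarrow> real" and k :: "'a \<Rightarrow> 'a \<Rightarrow> real"
  assumes k_nonneg: "\<And>x y. 0 \<le> k x y"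
    and k_int: "\<And>x. has_bochner_integral \<mu> (k x) 1"
    and meas: "\<And>t. t \<in> {0<..<T} \<Longrightarrow> (\<lambda>y. w y t) \<in> borel_measurable \<mu>"
    and bounded: "AE x in \<mu>. \<forall>t\<in>{0<..<T}. \<bar>w x t\<bar> \<le> C"
    and cont: "\<And>x. continuous_on {0..T} (w x)"
    and deriv: "\<And>x t. t \<in> {0<..<T} \<Longrightarrow> (w x has_real_derivative w' x t) (at t)"
    and subsol: "\<And>x t. t \<in> {0<..<T} \<Longrightarrow> w' x t \<le> (\<integral>y. k x y * w y t \<partial>\<mu>) - w x t"
    and init: "\<And>x. w x 0 \<le> 0"
    and t: "t \<in> {0..T}"
  shows "w x t \<le> 0"
proof -
  \<comment> \<open>This bounds \<open>exp t * w y t\<close> up to time \<open>T\<close>; the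
    maximum with 0 allows \<open>exp t\<close> to be replaced by \<open>exp T\<close> whatever the
    sign of \<open>C\<close>.\<close>
  define K where "K = exp T * max C 0"
  \<comment> \<open>An almost everywhere bound suffices as input because only the integral sees it.
    The output holds everywhere because the differential inequality is assumed at every
    point.\<close>
  have step: "exp t * w x t \<le> K * t ^ Suc n / fact (Suc n)"
    if ae: "AE y in \<mu>. \<forall>t\<in>{0<..<T}. exp t * w y t \<le> K * t ^ n / fact n" and t: "t \<in> {0..T}"
    for n t x
  proof -
    let ?f = "\<lambda>t. exp t * w x t - K * t ^ Suc n / fact (Suc n)"
    have "?f t \<le> ?f 0"
    \<comment> \<open>Derivatives are used only strictly between 0 and \<open>t\<close>; continuity
      takes care of the endpoints, including \<open>t = T\<close>.\<close>
    proof (rule DERIV_nonpos_imp_decreasing_open[where f = ?f])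
      show "0 \<le> t" using t by simp
      show "continuous_on {0..t} ?f"
        using t by (intro continuous_intros continuous_on_subset[OF cont]) auto
      fix r assume r: "0 < r" "r < t"
      then have r': "r \<in> {0<..<T}" using t by auto
      let ?d = "exp r * w x r + exp r * w' x r - K * r ^ n / fact n"
      \<comment> \<open>The factor \<open>exp\<close> contributes the summand \<open>w x r\<close>,
        which cancels the \<open>- w x r\<close> of the operator and leaves only the integral with
        its nonnegative kernel of mass one.\<close>
      have "exp r * (w x r + w' x r) \<le> exp r * (\<integral>y. k x y * w y r \<partial>\<mu>)"
        using subsol[OF r', of x] by (intro mult_left_mono) auto
      also have "\<dots> = (\<integral>y. k x y * (exp r * w y r) \<partial>\<mu>)"
        by (simp add: ac_simps flip: integral_mult_right_zero)
      also have "\<dots> \<le> (\<integral>y. k x y * (K * r ^ n / fact n) \<partial>\<mu>)"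
      proof (rule integral_mono_AE)
        have "AE y in \<mu>. \<bar>exp r * w y r\<bar> \<le> exp r * C"
          using bounded by eventually_elim (use r' in \<open>auto simp: abs_mult\<close>)
        then show "integrable \<mu> (\<lambda>y. k x y * (exp r * w y r))"
          using k_int[of x] meas[OF r']
          by (intro integrable_mult_AE_bounded) (auto simp: has_bochner_integral_iff)
        show "integrable \<mu> (\<lambda>y. k x y * (K * r ^ n / fact n))"
          using k_int[of x] by (auto simp: has_bochner_integral_iff)
        show "AE y in \<mu>. k x y * (exp r * w y r) \<le> k x y * (K * r ^ n / fact n)"
          using ae by eventually_elim (rule mult_left_mono, use r' k_nonneg in auto)
      qed
      also have "\<dots> = K * r ^ n / fact n"
        using k_int[of x] by (simp add: has_bochner_integral_iff)
      finally have d: "?d \<le> 0" by (simp add: algebra_simps)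
      have "((\<lambda>t. K * t ^ Suc n / fact (Suc n)) has_real_derivative
          K * (real (Suc n) * r ^ n) / fact (Suc n)) (at r)"
        using DERIV_pow[of "Suc n" r UNIV] by (intro DERIV_cdivide DERIV_cmult) simp
      then have "((\<lambda>t. K * t ^ Suc n / fact (Suc n)) has_real_derivative K * r ^ n / fact n) (at r)"
        by (simp del: of_nat_Suc power_Suc)
      moreover have "((\<lambda>t. exp t * w x t) has_real_derivative exp r * w x r + exp r * w' x r) (at r)"
        by (auto intro!: derivative_eq_intros deriv[OF r'])
      ultimately have "(?f has_real_derivative ?d) (at r)"
        by (intro DERIV_diff)
      with d show "\<exists>y. (?f has_real_derivative y) (at r) \<and> y \<le> 0" by blast
    qed
    also have "\<dots> \<le> 0" using init by simp
    finally show ?thesis by simp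
  qed
  have base: "AE y in \<mu>. \<forall>t\<in>{0<..<T}. exp t * w y t \<le> K * t ^ 0 / fact 0"
    using bounded
  proof eventually_elim
    case (elim y)
    show ?case
    proof
      fix t assume t: "t \<in> {0<..<T}"
      have "exp t * w y t \<le> exp t * max C 0"
        using elim t by (intro mult_left_mono) force+
      also have "\<dots> \<le> K"
        unfolding K_def using t by (intro mult_right_mono) auto
      finally show "exp t * w y t \<le> K * t ^ 0 / fact 0" by simp
    qed
  qed
  \<comment> \<open>The exponent starts at 1: the bound of order 0 is known only almost
    everywhere.\<close>
  have bound: "\<forall>x. \<forall>t\<in>{0..T}. exp t * w x t \<le> K * t ^ Suc n / fact (Suc n)" for n
  proof (induction n)
    case 0
    show ?case using step[OF base] by blast
  next
    case (Suc n)
    show ?case using step[where n = "Suc n"] Suc by auto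
  qed
  \<comment> \<open>These are \<open>K\<close> times the terms of the convergent exponential
    series.\<close>
  have "(\<lambda>n. K * (t ^ Suc n / fact (Suc n))) \<longlonglongrightarrow> K * 0"
    using LIMSEQ_Suc[OF summable_LIMSEQ_zero[OF summable_exp[of t]]]
    by (intro tendsto_mult tendsto_const) (simp add: field_simps)
  moreover have "exp t * w x t \<le> K * (t ^ Suc n / fact (Suc n))" for n
    using bound[of n] t by simp
  ultimately have "exp t * w x t \<le> 0"
    by (intro LIMSEQ_le_const[where X = "\<lambda>n. K * (t ^ Suc n / fact (Suc n))"]) auto
  then show ?thesis by (simp add: mult_le_0_iff)
qed


section \<open>Application to the manifold\<close>

theorem proposition2p1:
  fixes A :: "('a::{t2_space,second_countable_topology}, 'n::finite) chart set"
    and g :: "('a, 'n) metric_tensor"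
    and origin :: 'a
    and \<tau> :: "'a \<Rightarrow> 'a \<Rightarrow> 'a"
    and \<mu> :: "'a measure"
    and J :: "real \<Rightarrow> real"
    and s :: "'a \<Rightarrow> 'a \<Rightarrow> real"
    and T :: real
    and u v u\<^sub>t v\<^sub>t :: "'a \<Rightarrow> real \<Rightarrow> real"
  defines "s \<equiv> geodesic_dist A g"
  assumes "riemannian_manifold A g"
    and "\<And>x. riemannian_isometry A g (\<tau> x)"
    and "\<And>x. \<tau> x x = origin"
    and "sets borel \<subseteq> sets \<mu>"
    and "\<And>x. invariant_measure \<mu> (\<tau> x)"
    and "\<And>r. r \<ge> 0 \<Longrightarrow> J r \<ge> 0"
    and "has_bochner_integral \<mu> (\<lambda>x. J (s x origin)) 1"
    and "T > 0"
    and "integrable \<mu> (\<lambda>x. J (s x origin) * (1 + (s x origin)\<^sup>2))"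
    and "continuous_on (UNIV \<times> {0..T}) (\<lambda>(x, t). u x t)"
    and "continuous_on (UNIV \<times> {0..T}) (\<lambda>(x, t). v x t)"
    and "(\<lambda>(x, t). u x t) \<in> Linfty (\<mu> \<Otimes>\<^sub>M restrict_space lborel {0<..<T})"
    and "(\<lambda>(x, t). v x t) \<in> Linfty (\<mu> \<Otimes>\<^sub>M restrict_space lborel {0<..<T})"
    and "\<And>x t. t \<in> {0<..T} \<Longrightarrow> (u x has_real_derivative u\<^sub>t x t) (at t within {0..T})"
    and "\<And>x t. t \<in> {0<..T} \<Longrightarrow> (v x has_real_derivative v\<^sub>t x t) (at t within {0..T})"
    and "\<And>x t. t \<in> {0<..T} \<Longrightarrow>
           u\<^sub>t x t - nonlocal_op J s \<mu> (\<lambda>y. u y t) x \<le> v\<^sub>t x t - nonlocal_op J s \<mu> (\<lambda>y. v y t) x"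
    and "\<And>x. u x 0 \<le> v x 0"
  shows "\<forall>x. \<forall>t\<in>{0..T}. u x t \<le> v x t"
proof (intro allI ballI)
  fix x t assume t: "t \<in> {0..T}"
  note A = assms(2)[unfolded riemannian_manifold_def]
  \<comment> \<open>Apply the isometry \<open>\<tau> x\<close>, which sends \<open>x\<close> to
    \<open>origin\<close>, then swap the arguments by symmetry. Invariance of \<mu> under
    \<open>\<tau> x\<close> then moves the normalization from \<open>origin\<close> to every
    \<open>x\<close>.\<close>
  have s_eq: "s x y = s (\<tau> x y) origin" for x y
    using geodesic_dist_isometry[of A g "\<tau> x" x y] geodesic_dist_commute[of A g "\<tau> x y" origin]
      A assms(3,4) unfolding s_def by simp
  have s_nonneg: "0 \<le> s x y" for x y by (simp add: s_def geodesic_dist_def)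
  have k_int: "has_bochner_integral \<mu> (\<lambda>y. J (s x y)) 1" for x
  proof -
    have \<tau>: "\<tau> x \<in> measurable \<mu> \<mu>" "distr \<mu> \<mu> (\<tau> x) = \<mu>"
      using assms(6)[of x] by (auto simp: invariant_measure_def)
    have J: "integrable \<mu> (\<lambda>y. J (s y origin))" "(\<integral>y. J (s y origin) \<partial>\<mu>) = 1"
      using assms(8) by (auto simp: has_bochner_integral_iff)
    have "integrable \<mu> (\<lambda>y. J (s (\<tau> x y) origin))"
      using integrable_distr[OF \<tau>(1), of "\<lambda>y. J (s y origin)"] J(1) \<tau>(2) by simp
    moreover have "(\<integral>y. J (s (\<tau> x y) origin) \<partial>\<mu>) = 1"
      using integral_distr[OF \<tau>(1), of "\<lambda>y. J (s y origin)"] J \<tau>(2)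
      by (simp add: borel_measurable_integrable)
    ultimately show ?thesis
      unfolding s_eq[of x] by (simp add: has_bochner_integral_iff)
  qed
  have cont_t: "continuous_on {0..T} (f x)"
    if "continuous_on (UNIV \<times> {0..T}) (\<lambda>(x, t). f x t)" for f :: "'a \<Rightarrow> real \<Rightarrow> real" and x
    using continuous_on_compose2[OF that continuous_on_Pair[OF continuous_on_const continuous_on_id],
        of x "{0..T}"] by auto
  have meas: "(\<lambda>x. f x t) \<in> borel_measurable \<mu>"
    if "continuous_on (UNIV \<times> {0..T}) (\<lambda>(x, t). f x t)" "t \<in> {0<..<T}"
    for f :: "'a \<Rightarrow> real \<Rightarrow> real" and t
  proof -
    have "continuous_on UNIV (\<lambda>x. f x t)"
      using continuous_on_compose2[OF that(1) continuous_on_Pair[OF continuous_on_id continuous_on_const],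
          of t UNIV] that(2) by (auto simp: image_subset_iff)
    then have "(\<lambda>x. f x t) \<in> borel_measurable borel" by (rule borel_measurable_continuous_onI)
    \<comment> \<open>\<mu> may have more measurable sets than the Borel ones; the inclusion still
      forces its space to be the whole manifold.\<close>
    moreover have "UNIV \<in> sets \<mu>" by (rule subsetD[OF assms(5)]) simp
    then have "space \<mu> = UNIV" using sets.sets_into_space by blast
    ultimately show ?thesis using assms(5) by (auto simp: measurable_def)
  qed
  have bounded: "\<exists>C. AE x in \<mu>. \<forall>t\<in>{0<..<T}. \<bar>f x t\<bar> \<le> C"
    if "continuous_on (UNIV \<times> {0..T}) (\<lambda>(x, t). f x t)"
      "(\<lambda>(x, t). f x t) \<in> Linfty (\<mu> \<Otimes>\<^sub>M restrict_space lborel {0<..<T})"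
    for f :: "'a \<Rightarrow> real \<Rightarrow> real"
  proof -
    have "continuous_on {0<..<T} (f x)" for x
      by (rule continuous_on_subset[OF cont_t[OF that(1)]]) auto
    from Linfty_AE_bounded_in_time[OF that(2) this] show ?thesis by blast
  qed
  obtain Cu Cv where Cu: "AE x in \<mu>. \<forall>t\<in>{0<..<T}. \<bar>u x t\<bar> \<le> Cu"
    and Cv: "AE x in \<mu>. \<forall>t\<in>{0<..<T}. \<bar>v x t\<bar> \<le> Cv"
    using bounded[OF assms(11,13)] bounded[OF assms(12,14)] by blast
  \<comment> \<open>Since a nonintegrable function has Bochner integral 0, splitting the integral of
    the difference requires integrability for \<open>u\<close> and \<open>v\<close>
    separately.\<close>
  have int: "integrable \<mu> (\<lambda>y. J (s x y) * f y t)"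
    if "continuous_on (UNIV \<times> {0..T}) (\<lambda>(x, t). f x t)" "t \<in> {0<..<T}"
      "AE x in \<mu>. \<forall>t\<in>{0<..<T}. \<bar>f x t\<bar> \<le> C"
    for f :: "'a \<Rightarrow> real \<Rightarrow> real" and x t C
  proof (rule integrable_mult_AE_bounded[OF _ meas[OF that(1,2)]])
    show "integrable \<mu> (\<lambda>y. J (s x y))" using k_int by (simp add: has_bochner_integral_iff)
    show "AE y in \<mu>. \<bar>f y t\<bar> \<le> C" using that(3) by eventually_elim (use that(2) in blast)
  qed
  have "u x t - v x t \<le> 0"
  proof (rule nonlocal_subsolution_nonpos[where k = "\<lambda>x y. J (s x y)" and w = "\<lambda>x t. u x t - v x t"
        and w' = "\<lambda>x t. u\<^sub>t x t - v\<^sub>t x t" and C = "Cu + Cv" and T = T and \<mu> = \<mu>])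
    show "0 \<le> J (s x y)" for x y by (intro assms(7) s_nonneg)
    show "has_bochner_integral \<mu> (\<lambda>y. J (s x y)) 1" for x by (rule k_int)
    show "(\<lambda>y. u y t - v y t) \<in> borel_measurable \<mu>" if "t \<in> {0<..<T}" for t
      using meas[OF assms(11) that] meas[OF assms(12) that] by simp
    show "AE x in \<mu>. \<forall>t\<in>{0<..<T}. \<bar>u x t - v x t\<bar> \<le> Cu + Cv"
      using Cu Cv by eventually_elim (force simp: abs_le_iff)
    show "continuous_on {0..T} (\<lambda>t. u x t - v x t)" for x
      by (intro continuous_intros cont_t assms(11,12))
    show "u x 0 - v x 0 \<le> 0" for x using assms(18) by simp
    show "t \<in> {0..T}" by (rule t)
    fix x t assume t: "t \<in> {0<..<T}"
    then have "at t within {0..T} = at t" by (intro at_within_Icc_at) auto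
    then show "((\<lambda>t. u x t - v x t) has_real_derivative u\<^sub>t x t - v\<^sub>t x t) (at t)"
      using assms(15)[of t x] assms(16)[of t x] t by (auto intro: DERIV_diff)
    have "(\<integral>y. J (s x y) * (u y t - v y t) \<partial>\<mu>) =
        (\<integral>y. J (s x y) * u y t \<partial>\<mu>) - (\<integral>y. J (s x y) * v y t \<partial>\<mu>)"
      using int[OF assms(11) t Cu] int[OF assms(12) t Cv] by (simp add: right_diff_distrib)
    then show "u\<^sub>t x t - v\<^sub>t x t \<le> (\<integral>y. J (s x y) * (u y t - v y t) \<partial>\<mu>) - (u x t - v x t)"
      using assms(17)[of t x] t by (simp add: nonlocal_op_def)
  qed
  then show "u x t \<le> v x t" by simp
qed

end
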